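(* Let $\mathbb{X}$ and $\mathbb{Y}$ be real Banach spaces of dimensions $n$ and $m$ respectively. Let $\{f_1,f_2,\dots,f_k\}$ be a set of $k$ ($k\le n$) linearly independent functionals in $\mathbb{X}^*$ and let $\{g_1,g_2,\dots,g_p\}$ be a set of $p$ ($p<k$, $p\le m$) linearly independent functionals in $\mathbb{Y}^*$. Let $F=\mathrm{co}(\{f_1,f_2,\dots,f_k\})$ and $$G=\Big\{\sum_{i=1}^{p}\beta_i g_i : \sum_{i=1}^{p}\beta_i=1,\ \beta_i\in\mathbb{R}\ \text{for all } i=1,2,\dots,p\Big\}.$$ Let $A=\bigcup_{f\in F}\ker(f)$ and $B=\bigcup_{g\in G}\ker(g)$. If $T:\mathbb{X}\to\mathbb{Y}$ is a bounded linear operator such that $T(A)\subset B$, then $T(\mathbb{X})\subset B$.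
   Context: $\mathrm{co}(S)$ denotes the convex hull of a nonempty set $S$. $\mathbb{X}^*$ denotes the dual space of $\mathbb{X}$. *)

theory Defs
  imports "HOL-Analysis.Analysis"
begin

text \<open>
  The library's \<^const>\<open>dim\<close> is 0 on infinite-dimensional spaces (the cardinality of an infinite
  basis), so finite-dimensionality is part of the definition.
\<close>
definition has_dimension :: "'a::real_vector itself \<Rightarrow> nat \<Rightarrow> bool" where
  "has_dimension _ n \<longleftrightarrow> (\<exists>S::'a set. finite S \<and> span S = UNIV) \<and> dim (UNIV :: 'a set) = n"

definition ker :: "('a::real_normed_vector \<Rightarrow>\<^sub>L 'b::real_normed_vector) \<Rightarrow> 'a set" where
  "ker f = {x. blinfun_apply f x = 0}"

text \<open>
  Linear independence of a family: the library's \<^const>\<open>independent\<close> concerns the set of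
  values, so repetitions are excluded separately.
\<close>
definition independent_family :: "('i \<Rightarrow> 'v::real_vector) \<Rightarrow> 'i set \<Rightarrow> bool" where
  "independent_family f I \<longleftrightarrow> inj_on f I \<and> independent (f ` I)"

end

theory Submission
  imports Defs
begin

text \<open>
  Membership in \<open>B\<close> depends on a point \<open>y\<close> only through the values \<open>g\<^sub>i y\<close>, so every \<open>x\<close> may be
  moved along a direction that all the functionals \<open>g\<^sub>i \<circ> T\<close> annihilate without affecting whether
  \<open>T x\<close> lies in \<open>B\<close>. There are only \<open>p < k\<close> of these functionals, so they cannot span all the
  independent \<open>f\<^sub>j\<close>; by duality some direction \<open>v\<close> that they all annihilate satisfies \<open>f\<^sub>j v \<noteq> 0\<close>
  for some \<open>j\<close>. The line \<open>x + t v\<close> then meets \<open>ker f\<^sub>j\<close>, which is part of \<open>A\<close> because \<open>f\<^sub>j\<close> is a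
  vertex of the convex hull. The image of the meeting point lies in \<open>B\<close>, hence so does \<open>T x\<close>.
\<close>

text \<open>
  Induction on the number of functionals. If the new functional \<open>\<phi>\<^sub>a\<close> does not vanish on the common
  kernel of the others, rescale a witness to \<open>u\<close> with \<open>\<phi>\<^sub>a u = 1\<close>; projecting along \<open>u\<close> maps that
  common kernel into the kernel of \<open>\<phi>\<^sub>a\<close>, which shows that \<open>h - h(u) \<phi>\<^sub>a\<close> vanishes on it.
\<close>
lemma vanishing_on_common_kernel_in_span:
  fixes h :: "'a::real_normed_vector \<Rightarrow>\<^sub>L real" and \<phi> :: "'i \<Rightarrow> 'a \<Rightarrow>\<^sub>L real"
  assumes "finite I" and "(\<Inter>i\<in>I. ker (\<phi> i)) \<subseteq> ker h"
  shows "h \<in> span (\<phi> ` I)"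
  using assms
proof (induction I arbitrary: h rule: finite_induct)
  case empty
  then have "h = 0"
    by (auto simp: ker_def intro!: blinfun_eqI)
  then show ?case
    by simp
next
  case (insert a I)
  let ?K = "\<Inter>i\<in>I. ker (\<phi> i)"
  show ?case
  proof (cases "?K \<subseteq> ker (\<phi> a)")
    case True
    with insert.prems have "?K \<subseteq> ker h"
      by auto
    then have "h \<in> span (\<phi> ` I)"
      by (rule insert.IH)
    then show ?thesis
      using span_mono[of "\<phi> ` I" "\<phi> ` insert a I"] by auto
  next
    case False
    then obtain w where w: "w \<in> ?K" "\<phi> a w \<noteq> 0"
      by (auto simp: ker_def)
    define u where "u = w /\<^sub>R \<phi> a w"
    have u: "\<phi> i u = 0" if "i \<in> I" for i
      using w that by (auto simp: u_def ker_def blinfun.scaleR_right)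
    have ua: "\<phi> a u = 1"
      using w by (simp add: u_def blinfun.scaleR_right)
    have "?K \<subseteq> ker (h - h u *\<^sub>R \<phi> a)"
    proof
      fix v assume v: "v \<in> ?K"
      have "v - \<phi> a v *\<^sub>R u \<in> (\<Inter>i\<in>insert a I. ker (\<phi> i))"
        using v u ua by (auto simp: ker_def blinfun.diff_right blinfun.scaleR_right)
      then have "v - \<phi> a v *\<^sub>R u \<in> ker h"
        using insert.prems by blast
      then show "v \<in> ker (h - h u *\<^sub>R \<phi> a)"
        by (simp add: ker_def blinfun.diff_right blinfun.scaleR_right
            blinfun.diff_left blinfun.scaleR_left mult.commute)
    qed
    then have "h - h u *\<^sub>R \<phi> a \<in> span (\<phi> ` I)"
      by (rule insert.IH)
    then show ?thesis
      by (auto simp: span_insert)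
  qed
qed

text \<open>
  If every \<open>f\<^sub>j\<close> vanished on the common kernel, the span of the \<open>\<phi>\<^sub>i\<close> would contain more independent
  elements than it has generators.
\<close>
lemma separating_vector_in_common_kernel:
  fixes f :: "'j \<Rightarrow> 'a::real_normed_vector \<Rightarrow>\<^sub>L real" and \<phi> :: "'i \<Rightarrow> 'a \<Rightarrow>\<^sub>L real"
  assumes "independent_family f J" and "finite I" and "card I < card J"
  obtains v j where "j \<in> J" and "f j v \<noteq> 0" and "\<And>i. i \<in> I \<Longrightarrow> \<phi> i v = 0"
proof -
  have "\<not> f ` J \<subseteq> span (\<phi> ` I)"
  proof
    assume "f ` J \<subseteq> span (\<phi> ` I)"
    then have "card (f ` J) \<le> card (\<phi> ` I)"
      using assms independent_span_bound[of "\<phi> ` I" "f ` J"]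
      by (simp add: independent_family_def)
    also have "\<dots> \<le> card I"
      using assms by (intro card_image_le)
    finally show False
      using assms by (simp add: independent_family_def card_image)
  qed
  then obtain j where j: "j \<in> J" "f j \<notin> span (\<phi> ` I)"
    by auto
  then have "\<not> (\<Inter>i\<in>I. ker (\<phi> i)) \<subseteq> ker (f j)"
    using vanishing_on_common_kernel_in_span \<open>finite I\<close> by blast
  with j that show thesis
    by (auto simp: ker_def)
qed

theorem theorem2p7:
  fixes f :: "nat \<Rightarrow> ('x::banach \<Rightarrow>\<^sub>L real)"
    and g :: "nat \<Rightarrow> ('y::banach \<Rightarrow>\<^sub>L real)"
    and T :: "'x \<Rightarrow>\<^sub>L 'y"
    and n m k p :: nat
    and F :: "('x \<Rightarrow>\<^sub>L real) set" and G :: "('y \<Rightarrow>\<^sub>L real) set"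
    and A :: "'x set" and B :: "'y set"
  assumes "has_dimension TYPE('x) n" and "has_dimension TYPE('y) m"
    and "k \<le> n" and "p < k" and "p \<le> m"
    and "independent_family f {1..k}" and "independent_family g {1..p}"
    and "F = convex hull (f ` {1..k})"
    and "G = {(\<Sum>i=1..p. \<beta> i *\<^sub>R g i) | \<beta> :: nat \<Rightarrow> real. (\<Sum>i=1..p. \<beta> i) = 1}"
    and "A = (\<Union>h\<in>F. ker h)" and "B = (\<Union>h\<in>G. ker h)"
    and "blinfun_apply T ` A \<subseteq> B"
  shows "range (blinfun_apply T) \<subseteq> B"
proof
  fix y assume "y \<in> range (blinfun_apply T)"
  then obtain x where y: "y = T x"
    by auto
  obtain v j where j: "j \<in> {1..k}" and fv: "f j v \<noteq> 0"
    and gv: "\<And>i. i \<in> {1..p} \<Longrightarrow> (g i o\<^sub>L T) v = 0"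
  proof (rule separating_vector_in_common_kernel[of f "{1..k}" "{1..p}" "\<lambda>i. g i o\<^sub>L T"])
    show "independent_family f {1..k}"
      by fact
    show "card {1..p} < card {1..k}"
      using \<open>p < k\<close> by simp
  qed auto
  \<comment> \<open>the point where the line through \<open>x\<close> in direction \<open>v\<close> meets the kernel of \<open>f j\<close>\<close>
  define z where "z = x - (f j x / f j v) *\<^sub>R v"
  have "z \<in> ker (f j)"
    using fv by (simp add: z_def ker_def blinfun.diff_right blinfun.scaleR_right)
  moreover have "f j \<in> F"
    using j \<open>F = convex hull (f ` {1..k})\<close> by (simp add: hull_inc)
  ultimately have "z \<in> A"
    using \<open>A = (\<Union>h\<in>F. ker h)\<close> by blast
  then have "T z \<in> B"
    using \<open>blinfun_apply T ` A \<subseteq> B\<close> by blast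
  then obtain \<beta> :: "nat \<Rightarrow> real"
    where \<beta>: "(\<Sum>i=1..p. \<beta> i) = 1" and Tz: "T z \<in> ker (\<Sum>i=1..p. \<beta> i *\<^sub>R g i)"
    unfolding \<open>B = (\<Union>h\<in>G. ker h)\<close> \<open>G = _\<close> by blast
  have "g i (T z) = g i (T x)" if "i \<in> {1..p}" for i
    using gv[OF that] by (simp add: z_def blinfun.diff_right blinfun.scaleR_right)
  then have "(\<Sum>i=1..p. \<beta> i *\<^sub>R g i) (T x) = (\<Sum>i=1..p. \<beta> i *\<^sub>R g i) (T z)"
    by (simp add: blinfun.sum_left blinfun.scaleR_left)
  with Tz have "T x \<in> ker (\<Sum>i=1..p. \<beta> i *\<^sub>R g i)"
    by (simp add: ker_def)
  with \<beta> show "y \<in> B"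
    unfolding y \<open>B = (\<Union>h\<in>G. ker h)\<close> \<open>G = _\<close> by blast
qed

end
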